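(* For every $k\in\mathbb Z$, $$J_k^{(\boldsymbol\alpha;\boldsymbol\beta)}=\sum_{i,j\in\mathbb Z}A_{ij}^k\;:\!\psi_i\psi_j^*\!:\;.$$
   Context: Shifted powers: $\boldsymbol\alpha=(\alpha_i)_{i\in\mathbb Z}$, $\boldsymbol\beta=(\beta_i)_{i\in\mathbb Z}$ are sequences in $\mathbb C$. For $k\in\mathbb Z$, $(z;\boldsymbol\alpha)^k=\prod_{i=1}^k(1-z\alpha_i)$ if $k\ge 0$ and $\prod_{i=k+1}^{0}(1-z\alpha_i)^{-1}$ if $k<0$; $(z|\boldsymbol\beta)^k=\prod_{i=1}^k(z-\beta_i)$ if $k\ge0$ and $\prod_{i=k+1}^0(z-\beta_i)^{-1}$ if $k<0$. The Clifford algebra is generated by $\psi_i,\psi_i^*$ ($i\in\mathbb Z$) with $[\psi_i,\psi_j]_+=[\psi_i^*,\psi_j^*]_+=0$, $[\psi_i,\psi_j^*]_+=\delta_{ij}$. Normal ordering, extended bilinearly: $:\!\psi_i\psi_j^*\!:\,=\psi_i\psi_j^*$ if $i>0$ and $=-\psi_j^*\psi_i$ if $i\le0$. Infinite linear combinations of the $:\!\psi_i\psi_j^*\!:$ are regarded as operators on the fermionic Fock space (spanned by semi-infinite monomials $v_{i_m}\wedge v_{i_{m-1}}\wedge\cdots$, $i_m>i_{m-1}>\cdots$, $i_k=k$ for $k\ll0$, with $\psi_j$ acting by $v_j\wedge$ and $\psi_j^*$ by contraction against $v_j$) with values in its formal completion. Deformed fields: $\psi(z|\boldsymbol\alpha;\boldsymbol\beta)=\sum_i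 z\frac{(z|\boldsymbol\beta)^{i-1}}{(z;\boldsymbol\alpha)^i}\psi_i$, $\psi^*(w|\boldsymbol\alpha;\boldsymbol\beta)=\sum_j(1-\alpha_j\beta_j)\frac{(w;\boldsymbol\alpha)^{j-1}}{(w|\boldsymbol\beta)^j}\psi_j^*$. The deformed current operators $J_k^{(\boldsymbol\alpha;\boldsymbol\beta)}$ are the Fourier modes in $:\!\psi(z|\boldsymbol\alpha;\boldsymbol\beta)\psi^*(z|\boldsymbol\alpha;\boldsymbol\beta)\!:\,=\sum_{k\in\mathbb Z}J_k^{(\boldsymbol\alpha;\boldsymbol\beta)}z^{-k}$, where the coefficient functions are expanded as Laurent series in an annulus around a circle of radius $r$ with $|\beta_i|<r<|\alpha_j^{-1}|$ for all $i,j$ (assumed to exist). Coefficients: $e_r(-\boldsymbol\alpha_{(i,j)})$ is the elementary symmetric polynomial of degree $r$ in $-\alpha_{i+1},\dots,-\alpha_{j-1}$ and $h_s(\boldsymbol\beta_{[i,j]})$ the complete homogeneous symmetric polynomial of degree $s$ in $\beta_i,\dots,\beta_j$ (similarly with the roles of $\boldsymbol\alpha,\boldsymbol\beta$ exchanged; with an empty set of variables these are $1$ in degree $0$ and $0$ in positive degree). For $k>0$ and $i\ne j$, $$A_{ij}^k=(1-\alpha_j\beta_j)\sum_{r-s=j-i-k}e_r(-\boldsymbol\alpha_{(i,j)})h_s(\boldsymbol\beta_{[i,j]}),\qquad A_{ij}^{-k}=(1-\alpha_j\beta_j)\sum_{r-s=j-i+k}h_r(\boldsymbol\alpha_{[j,i]})e_s(-\boldsymbol\beta_{(j,i)}),$$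 with sums over $r,s\ge0$; $A_{ii}^k=\beta_i^k$, $A_{ii}^{-k}=\alpha_i^k$; and $A_{ij}^0=\delta_{ij}$. (Thus for $k>0$, $A_{ij}^k=0$ if $j<i$ and $A_{ij}^{-k}=0$ if $j>i$.) *)

theory Defs
  imports
    "HOL-Analysis.Analysis"
    "HOL-Library.Poly_Mapping"
begin

section \<open>Shifted powers and symmetric polynomials\<close>

text \<open>\<open>shifted_pow_semi z \<alpha> k\<close> is \<open>(z;\<alpha>)\<^sup>k\<close> and \<open>shifted_pow_bar z \<beta> k\<close> is \<open>(z|\<beta>)\<^sup>k\<close>.\<close>

definition shifted_pow_semi :: "complex \<Rightarrow> (int \<Rightarrow> complex) \<Rightarrow> int \<Rightarrow> complex" where
  "shifted_pow_semi z \<alpha> k =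
     (if k \<ge> 0 then \<Prod>i\<in>{1..k}. 1 - z * \<alpha> i
      else \<Prod>i\<in>{k+1..0}. inverse (1 - z * \<alpha> i))"

definition shifted_pow_bar :: "complex \<Rightarrow> (int \<Rightarrow> complex) \<Rightarrow> int \<Rightarrow> complex" where
  "shifted_pow_bar z \<beta> k =
     (if k \<ge> 0 then \<Prod>i\<in>{1..k}. z - \<beta> i
      else \<Prod>i\<in>{k+1..0}. inverse (z - \<beta> i))"

text \<open>Both symmetric polynomials are evaluated at the finite family \<open>(x l)\<close>, \<open>l \<in> I\<close>;
  a degree-\<open>s\<close> monomial of the complete one is a multiset of indices of size \<open>s\<close>.\<close>

definition elem_sym :: "nat \<Rightarrow> (int \<Rightarrow> complex) \<Rightarrow> int set \<Rightarrow> complex" where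
  "elem_sym r x I = (\<Sum>X | X \<subseteq> I \<and> card X = r. \<Prod>l\<in>X. x l)"

definition complete_sym :: "nat \<Rightarrow> (int \<Rightarrow> complex) \<Rightarrow> int set \<Rightarrow> complex" where
  "complete_sym s x I = (\<Sum>M | set_mset M \<subseteq> I \<and> size M = s. \<Prod>l\<in>#M. x l)"

text \<open>The coefficients \<open>A\<^sub>i\<^sub>j\<^sup>k\<close>. In both off-diagonal sums only finitely many pairs \<open>(r, s)\<close>
  contribute, since an elementary symmetric polynomial of degree larger than its number of
  variables vanishes; \<^const>\<open>Sum_any\<close> is the sum over that finite support. For \<open>k < 0\<close> the
  condition \<open>r - s = j - i + \<bar>k\<bar>\<close> reads \<open>r - s = j - i - k\<close>.\<close>

definition A_coeff ::
  "(int \<Rightarrow> complex) \<Rightarrow> (int \<Rightarrow> complex) \<Rightarrow> int \<Rightarrow> int \<Rightarrow> int \<Rightarrow> complex" where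
  "A_coeff \<alpha> \<beta> k i j =
     (if k = 0 then (if i = j then 1 else 0)
      else if k > 0 then
        (if i = j then \<beta> i ^ nat k
         else (1 - \<alpha> j * \<beta> j) *
           Sum_any (\<lambda>(r, s). if int r - int s = j - i - k
             then elem_sym r (\<lambda>l. - \<alpha> l) {i<..<j} * complete_sym s \<beta> {i..j} else 0))
      else
        (if i = j then \<alpha> i ^ nat (- k)
         else (1 - \<alpha> j * \<beta> j) *
           Sum_any (\<lambda>(r, s). if int r - int s = j - i - k
             then complete_sym r \<alpha> {j..i} * elem_sym s (\<lambda>l. - \<beta> l) {j<..<i} else 0)))"


section \<open>The fermionic Fock space\<close>

text \<open>The monomial \<open>v\<^bsub>i\<^sub>m\<^esub> \<and> v\<^bsub>i\<^sub>m\<^sub>-\<^sub>1\<^esub> \<and> \<dots>\<close> with \<open>i\<^sub>m > i\<^sub>m\<^sub>-\<^sub>1 > \<dots>\<close> and \<open>i\<^sub>k = k\<close> for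
  \<open>k \<lless> 0\<close> is represented by its set of indices, a set of integers which differs from
  the set of all non-positive integers by finitely many elements. All charges \<open>m\<close> are
  allowed; \<open>m\<close> is the number of positive elements minus the number of non-positive
  non-elements.\<close>

typedef semi_monomial = "{S :: int set. finite (S - {..0}) \<and> finite ({..0} - S)}"
  morphisms indices Semi_monomial
  by (rule exI[of _ "{..0}"]) simp

text \<open>Finite linear combinations of monomials, and arbitrary formal ones.\<close>

type_synonym fock = "semi_monomial \<Rightarrow>\<^sub>0 complex"
type_synonym fock_completion = "semi_monomial \<Rightarrow> complex"

text \<open>Sign of moving a factor \<open>v\<^sub>j\<close> past the factors of larger index.\<close>

definition wedge_sign :: "int \<Rightarrow> semi_monomial \<Rightarrow> complex" where
  "wedge_sign j S = (- 1) ^ card {i \<in> indices S. j < i}"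

definition psi :: "int \<Rightarrow> fock \<Rightarrow> fock" where
  "psi j v = (\<Sum>S\<in>Poly_Mapping.keys v.
     if j \<in> indices S then 0
     else Poly_Mapping.single (Semi_monomial (insert j (indices S)))
            (wedge_sign j S * Poly_Mapping.lookup v S))"

definition psi_star :: "int \<Rightarrow> fock \<Rightarrow> fock" where
  "psi_star j v = (\<Sum>S\<in>Poly_Mapping.keys v.
     if j \<in> indices S
     then Poly_Mapping.single (Semi_monomial (indices S - {j}))
            (wedge_sign j S * Poly_Mapping.lookup v S)
     else 0)"

definition normal_ordered :: "int \<Rightarrow> int \<Rightarrow> fock \<Rightarrow> fock" where
  "normal_ordered i j v =
     (if i > 0 then psi i (psi_star j v) else - psi_star j (psi i v))"

text \<open>The operator \<open>\<Sum>\<^sub>i\<^sub>,\<^sub>j c\<^sub>i\<^sub>j :\<psi>\<^sub>i\<psi>\<^sub>j\<^sup>*:\<close> from the Fock space to its completion, given by its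
  coordinates. Each coordinate is a finite sum, by \<open>finite_normal_ordered_support\<close> below.\<close>

definition quadratic_operator ::
  "(int \<Rightarrow> int \<Rightarrow> complex) \<Rightarrow> fock \<Rightarrow> fock_completion" where
  "quadratic_operator c v U =
     Sum_any (\<lambda>(i, j). c i j * Poly_Mapping.lookup (normal_ordered i j v) U)"


section \<open>Deformed fields and currents\<close>

text \<open>A formal combination \<open>\<Sum>\<^sub>i a\<^sub>i \<psi>\<^sub>i\<close> or \<open>\<Sum>\<^sub>j b\<^sub>j \<psi>\<^sub>j\<^sup>*\<close> is given by its coefficient family;
  normal ordering of a product of two such combinations is bilinear.\<close>

definition deformed_psi ::
  "(int \<Rightarrow> complex) \<Rightarrow> (int \<Rightarrow> complex) \<Rightarrow> complex \<Rightarrow> int \<Rightarrow> complex" where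
  "deformed_psi \<alpha> \<beta> z i = z * shifted_pow_bar z \<beta> (i - 1) / shifted_pow_semi z \<alpha> i"

definition deformed_psi_star ::
  "(int \<Rightarrow> complex) \<Rightarrow> (int \<Rightarrow> complex) \<Rightarrow> complex \<Rightarrow> int \<Rightarrow> complex" where
  "deformed_psi_star \<alpha> \<beta> w j =
     (1 - \<alpha> j * \<beta> j) * shifted_pow_semi w \<alpha> (j - 1) / shifted_pow_bar w \<beta> j"

definition normal_ordered_product ::
  "(int \<Rightarrow> complex) \<Rightarrow> (int \<Rightarrow> complex) \<Rightarrow> fock \<Rightarrow> fock_completion" where
  "normal_ordered_product a b = quadratic_operator (\<lambda>i j. a i * b j)"

definition current_field ::
  "(int \<Rightarrow> complex) \<Rightarrow> (int \<Rightarrow> complex) \<Rightarrow> complex \<Rightarrow> fock \<Rightarrow> fock_completion" where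
  "current_field \<alpha> \<beta> z = normal_ordered_product (deformed_psi \<alpha> \<beta> z) (deformed_psi_star \<alpha> \<beta> z)"

definition has_laurent_series_around_circle ::
  "real \<Rightarrow> (complex \<Rightarrow> complex) \<Rightarrow> (int \<Rightarrow> complex) \<Rightarrow> bool" where
  "has_laurent_series_around_circle \<rho> f c \<longleftrightarrow>
     (\<exists>\<rho>\<^sub>1 \<rho>\<^sub>2. 0 \<le> \<rho>\<^sub>1 \<and> \<rho>\<^sub>1 < \<rho> \<and> \<rho> < \<rho>\<^sub>2 \<and>
        (\<forall>z. \<rho>\<^sub>1 < cmod z \<and> cmod z < \<rho>\<^sub>2 \<longrightarrow> ((\<lambda>n. c n * z powi n) has_sum f z) UNIV))"

definition laurent_coeff :: "real \<Rightarrow> (complex \<Rightarrow> complex) \<Rightarrow> int \<Rightarrow> complex" where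
  "laurent_coeff \<rho> f = (THE c. has_laurent_series_around_circle \<rho> f c)"

text \<open>\<open>J\<^sub>k\<close> is the coefficient of \<open>z\<^bsup>-k\<^esup>\<close> of the operator-valued function \<^const>\<open>current_field\<close>,
  taken in each coordinate of the completed Fock space. Such a coordinate is a finite
  combination of the coefficient functions of the \<open>:\<psi>\<^sub>i\<psi>\<^sub>j\<^sup>*:\<close>.\<close>

definition deformed_current ::
  "real \<Rightarrow> (int \<Rightarrow> complex) \<Rightarrow> (int \<Rightarrow> complex) \<Rightarrow> int \<Rightarrow> fock \<Rightarrow> fock_completion" where
  "deformed_current \<rho> \<alpha> \<beta> k v U = laurent_coeff \<rho> (\<lambda>z. current_field \<alpha> \<beta> z v U) (- k)"


section \<open>Clifford relations and finiteness\<close>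

lemma finite_above: "finite {i \<in> indices S. j < i}"
proof -
  have "{i \<in> indices S. j < i} \<subseteq> (indices S - {..0}) \<union> {j<..0}" by auto
  moreover have "finite (indices S - {..0})" using indices[of S] by simp
  ultimately show ?thesis by (meson finite_UnI finite_greaterThanAtMost_int finite_subset)
qed

lemma indices_insert [simp]:
  "indices (Semi_monomial (insert j (indices S))) = insert j (indices S)"
proof (rule Semi_monomial_inverse)
  have "insert j (indices S) - {..0} \<subseteq> insert j (indices S - {..0})"
    and "{..0} - insert j (indices S) \<subseteq> {..0} - indices S" by auto
  then show "insert j (indices S) \<in> {S. finite (S - {..0}) \<and> finite ({..0} - S)}"
    using indices[of S] by (auto intro: finite_subset)
qed

lemma indices_remove [simp]:
  "indices (Semi_monomial (indices S - {j})) = indices S - {j}"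
proof (rule Semi_monomial_inverse)
  have "indices S - {j} - {..0} \<subseteq> indices S - {..0}"
    and "{..0} - (indices S - {j}) \<subseteq> insert j ({..0} - indices S)" by auto
  then show "indices S - {j} \<in> {S. finite (S - {..0}) \<and> finite ({..0} - S)}"
    using indices[of S] by (auto intro: finite_subset)
qed

lemma wedge_sign_remove [simp]: "wedge_sign j (Semi_monomial (indices S - {j})) = wedge_sign j S"
  unfolding wedge_sign_def by (rule arg_cong[of _ _ "\<lambda>X. (- 1) ^ card X"]) auto

lemma wedge_sign_insert [simp]:
  "wedge_sign j (Semi_monomial (insert j (indices S))) = wedge_sign j S"
  unfolding wedge_sign_def by (rule arg_cong[of _ _ "\<lambda>X. (- 1) ^ card X"]) auto

lemma lookup_psi:
  "Poly_Mapping.lookup (psi j v) U =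
     (if j \<in> indices U
      then wedge_sign j U * Poly_Mapping.lookup v (Semi_monomial (indices U - {j})) else 0)"
proof -
  have *: "S = Semi_monomial (indices U - {j})"
    if "j \<notin> indices S" "Semi_monomial (insert j (indices S)) = U" for S
  proof -
    have "indices U - {j} = indices S" using that indices_insert by fastforce
    then show ?thesis by (simp add: indices_inverse)
  qed
  let ?T = "Semi_monomial (indices U - {j})"
  have "Poly_Mapping.lookup (psi j v) U =
     (\<Sum>S\<in>Poly_Mapping.keys v. if S = ?T \<and> j \<in> indices U
        then wedge_sign j U * Poly_Mapping.lookup v ?T else 0)"
    unfolding psi_def lookup_sum
  proof (rule sum.cong, simp)
    fix S
    have "S = ?T \<and> j \<in> indices U \<longleftrightarrow> j \<notin> indices S \<and> Semi_monomial (insert j (indices S)) = U"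
    proof
      assume a: "S = ?T \<and> j \<in> indices U"
      then have "insert j (indices S) = indices U" by auto
      then show "j \<notin> indices S \<and> Semi_monomial (insert j (indices S)) = U"
        using a by (simp add: indices_inverse)
    qed (use * indices_insert in blast)
    then show "Poly_Mapping.lookup (if j \<in> indices S then 0
        else Poly_Mapping.single (Semi_monomial (insert j (indices S)))
          (wedge_sign j S * Poly_Mapping.lookup v S)) U =
      (if S = ?T \<and> j \<in> indices U then wedge_sign j U * Poly_Mapping.lookup v ?T else 0)"
      by (auto simp: lookup_single when_def)
  qed
  also have "\<dots> = (if j \<in> indices U then wedge_sign j U * Poly_Mapping.lookup v ?T else 0)"
    by (auto simp: sum.delta in_keys_iff)
  finally show ?thesis .
qed

lemma lookup_psi_star:
  "Poly_Mapping.lookup (psi_star j v) U =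
     (if j \<in> indices U then 0
      else wedge_sign j U * Poly_Mapping.lookup v (Semi_monomial (insert j (indices U))))"
proof -
  let ?T = "Semi_monomial (insert j (indices U))"
  have *: "S = ?T"
    if "j \<in> indices S" "Semi_monomial (indices S - {j}) = U" for S
  proof -
    have "indices U = indices S - {j}" using that indices_remove by fastforce
    then have "insert j (indices U) = indices S" using that by auto
    then show ?thesis by (simp add: indices_inverse)
  qed
  have "Poly_Mapping.lookup (psi_star j v) U =
     (\<Sum>S\<in>Poly_Mapping.keys v. if S = ?T \<and> j \<notin> indices U
        then wedge_sign j U * Poly_Mapping.lookup v ?T else 0)"
    unfolding psi_star_def lookup_sum
  proof (rule sum.cong, simp)
    fix S
    have "S = ?T \<and> j \<notin> indices U \<longleftrightarrow> j \<in> indices S \<and> Semi_monomial (indices S - {j}) = U"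
    proof
      assume a: "S = ?T \<and> j \<notin> indices U"
      then have "indices S - {j} = indices U" by auto
      then show "j \<in> indices S \<and> Semi_monomial (indices S - {j}) = U"
        using a by (simp add: indices_inverse)
    qed (use * indices_remove in blast)
    then show "Poly_Mapping.lookup (if j \<in> indices S
        then Poly_Mapping.single (Semi_monomial (indices S - {j}))
          (wedge_sign j S * Poly_Mapping.lookup v S) else 0) U =
      (if S = ?T \<and> j \<notin> indices U then wedge_sign j U * Poly_Mapping.lookup v ?T else 0)"
      by (auto simp: lookup_single when_def)
  qed
  also have "\<dots> = (if j \<in> indices U then 0 else wedge_sign j U * Poly_Mapping.lookup v ?T)"
    by (auto simp: sum.delta in_keys_iff)
  finally show ?thesis .
qed

lemma wedge_sign_insert_other:
  assumes "i \<notin> indices S" "i \<noteq> j"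
  shows "wedge_sign j (Semi_monomial (insert i (indices S))) =
    (if j < i then - wedge_sign j S else wedge_sign j S)"
proof (cases "j < i")
  case True
  then have "{k \<in> insert i (indices S). j < k} = insert i {k \<in> indices S. j < k}" by auto
  with True assms show ?thesis by (simp add: wedge_sign_def finite_above)
next
  case False
  then have "{k \<in> insert i (indices S). j < k} = {k \<in> indices S. j < k}" by auto
  with False show ?thesis by (simp add: wedge_sign_def)
qed

lemma wedge_sign_remove_other:
  assumes "i \<in> indices S" "i \<noteq> j"
  shows "wedge_sign j (Semi_monomial (indices S - {i})) =
    (if j < i then - wedge_sign j S else wedge_sign j S)"
proof -
  have "insert i (indices S) = indices S" using assms by auto
  then have "Semi_monomial (insert i (indices (Semi_monomial (indices S - {i})))) = S"
    by (simp add: indices_inverse)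
  with wedge_sign_insert_other[of i "Semi_monomial (indices S - {i})" j] assms
  show ?thesis by (auto split: if_splits)
qed

lemma wedge_sign_square: "wedge_sign j S * (wedge_sign j S * x) = x"
  by (simp add: wedge_sign_def flip: power_add mult.assoc)

lemma clifford_psi: "psi i (psi j v) + psi j (psi i v) = 0"
proof (rule poly_mapping_eqI)
  fix U
  have "indices U - {i} - {j} = indices U - {j} - {i}" by auto
  then show "Poly_Mapping.lookup (psi i (psi j v) + psi j (psi i v)) U = Poly_Mapping.lookup 0 U"
    by (cases i j rule: linorder_cases)
       (auto simp: lookup_add lookup_psi wedge_sign_remove_other)
qed

lemma clifford_psi_star: "psi_star i (psi_star j v) + psi_star j (psi_star i v) = 0"
proof (rule poly_mapping_eqI)
  fix U
  have "insert i (insert j (indices U)) = insert j (insert i (indices U))" by auto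
  then show "Poly_Mapping.lookup (psi_star i (psi_star j v) + psi_star j (psi_star i v)) U =
      Poly_Mapping.lookup 0 U"
    by (cases i j rule: linorder_cases)
       (auto simp: lookup_add lookup_psi_star wedge_sign_insert_other)
qed

lemma clifford_psi_psi_star:
  "psi i (psi_star j v) + psi_star j (psi i v) = (if i = j then v else 0)"
proof (rule poly_mapping_eqI)
  fix U
  have ins: "insert j (indices U) = indices U" if "j \<in> indices U" using that by auto
  have rem: "indices U - {j} = indices U" if "j \<notin> indices U" using that by auto
  have "insert j (indices U - {i}) = insert j (indices U) - {i}" if "i \<noteq> j" using that by auto
  then show "Poly_Mapping.lookup (psi i (psi_star j v) + psi_star j (psi i v)) U =
      Poly_Mapping.lookup (if i = j then v else 0) U"
    by (cases i j rule: linorder_cases)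
       (auto simp: lookup_add lookup_psi lookup_psi_star wedge_sign_insert_other
          wedge_sign_remove_other wedge_sign_square ins rem indices_inverse)
qed

lemma finite_indices_diff: "finite (indices S - indices U)"
proof -
  have "indices S - indices U \<subseteq> (indices S - {..0}) \<union> ({..0} - indices U)" by auto
  then show ?thesis using indices[of S] indices[of U] by (auto intro: finite_subset)
qed

lemma finite_normal_ordered_support:
  "finite {(i, j). Poly_Mapping.lookup (normal_ordered i j v) U \<noteq> 0}"
proof -
  define K where "K = Poly_Mapping.keys v"
  define A where "A = (indices U - {..0}) \<union> ({..0} - indices U) \<union> (\<Union>S\<in>K. indices U - indices S)"
  define B where "B = (\<Union>S\<in>K. indices S - indices U)"
  have "finite A" "finite B"
    using indices[of U]
    by (auto simp: A_def B_def K_def finite_indices_diff simp del: UN_simps UN_extend_simps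
        intro!: finite_UN_I)
  moreover have "(i, j) \<in> A \<times> (A \<union> B)"
    if nz: "Poly_Mapping.lookup (normal_ordered i j v) U \<noteq> 0" for i j
  proof (cases "i > 0")
    case True
    define T where "T = Semi_monomial (indices U - {i})"
    define S where "S = Semi_monomial (insert j (indices T))"
    have i: "i \<in> indices U" and j: "j \<notin> indices T" and S: "S \<in> K"
      using nz True
      by (auto simp: normal_ordered_def lookup_psi lookup_psi_star K_def in_keys_iff S_def T_def
          split: if_splits)
    have T: "indices T = indices U - {i}" unfolding T_def by (rule indices_remove)
    have S': "indices S = insert j (indices T)" unfolding S_def by (rule indices_insert)
    have "i \<in> A" using i True by (auto simp: A_def)
    moreover have "j = i \<or> j \<in> B" using i j S T S' by (auto simp: B_def)
    ultimately show ?thesis by auto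
  next
    case False
    define T where "T = Semi_monomial (insert j (indices U))"
    define S where "S = Semi_monomial (indices T - {i})"
    have j: "j \<notin> indices U" and i: "i \<in> indices T" and S: "S \<in> K"
      using nz False
      by (auto simp: normal_ordered_def lookup_psi lookup_psi_star K_def in_keys_iff S_def T_def
          split: if_splits)
    have T: "indices T = insert j (indices U)" unfolding T_def by (rule indices_insert)
    have S': "indices S = indices T - {i}" unfolding S_def by (rule indices_remove)
    show ?thesis
    proof (cases "i = j")
      case True
      then show ?thesis using j False by (auto simp: A_def)
    next
      case ne: False
      then have "i \<in> indices U - indices S" "j \<in> indices S - indices U"
        using i j T S' by auto
      then show ?thesis using S by (auto simp: A_def B_def)
    qed
  qed
  ultimately show ?thesis
    by (auto intro: finite_subset[of _ "A \<times> (A \<union> B)"])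
qed

end

theory Submission
  imports Defs "HOL-Complex_Analysis.Cauchy_Integral_Formula"
begin

text \<open>Each coordinate of the current is a finite linear combination of the coefficient functions
  \<open>f\<^sub>i\<^sub>j(z)\<close> of the \<open>:\<psi>\<^sub>i\<psi>\<^sub>j\<^sup>*:\<close>, with weights that do not depend on \<open>z\<close>. Hence it suffices that
  the Laurent coefficient of \<open>f\<^sub>i\<^sub>j\<close> at \<open>z\<^sup>n\<close> is \<open>A\<^sub>i\<^sub>j\<close> with upper index \<open>-n\<close> (\<open>has_laurent_series_kernel\<close>),
  and that a function has only one Laurent series around a circle (\<open>laurent_coeff_eqI\<close>).

  In \<open>f\<^sub>i\<^sub>j\<close> the factors of the shifted powers outside the interval between \<open>i\<close> and \<open>j\<close> cancel.
  For \<open>i < j\<close> this leaves, up to the constant \<open>1 - \<alpha>\<^sub>j\<beta>\<^sub>j\<close>, the power \<open>z\<close> to the \<open>i - j\<close> times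
  the product of \<open>1 - \<alpha>\<^sub>l z\<close> over \<open>i < l < j\<close> divided by the product of \<open>1 - \<beta>\<^sub>l / z\<close> over
  \<open>i \<le> l \<le> j\<close>. The first product generates the elementary symmetric polynomials in powers of
  \<open>z\<close>, the second quotient the complete ones in powers of \<open>1 / z\<close>, so multiplying the two
  series gives the defining sum of \<open>A\<^sub>i\<^sub>j\<close>. For \<open>i > j\<close> the same holds once, in the two
  products, \<open>\<alpha>\<close> and \<open>\<beta>\<close>, \<open>z\<close> and \<open>1 / z\<close>, \<open>i\<close> and \<open>j\<close> are exchanged. For \<open>i = j\<close> the function is a sum of two geometric series by
  partial fractions.

  For \<open>i < j\<close> one generating function yields the coefficients of all powers of \<open>z\<close>, whereas the
  definition of \<open>A\<^sub>i\<^sub>j\<close> switches to another formula when the upper index becomes negative. Both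
  formulas vanish there: the first would need at least \<open>j - i\<close> variables in its elementary factor,
  where only \<open>j - i - 1\<close> exist, and the second has a complete factor of positive degree in an empty
  set of variables. The case \<open>i > j\<close> is symmetric.\<close>

section \<open>Laurent coefficients on a circle\<close>

lemma contour_integral_powi_circlepath:
  assumes "0 < \<rho>"
  shows "((\<lambda>z. z powi n) has_contour_integral (if n = -1 then 2 * pi * \<i> else 0)) (circlepath 0 \<rho>)"
proof (cases "n = -1")
  case True
  have "((\<lambda>z. 1 / (z - 0)) has_contour_integral (2 * pi * \<i>)) (circlepath 0 \<rho>)"
    using Cauchy_integral_circlepath_simple[of "\<lambda>_. 1" 0 \<rho> 0] assms by auto
  with True show ?thesis by (simp add: power_int_minus field_simps)
next
  case False
  then have ne: "complex_of_int (n + 1) \<noteq> 0" by (metis add_eq_0_iff2 of_int_eq_0_iff)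
  have "((\<lambda>z. z powi n) has_contour_integral 0) (circlepath 0 \<rho>)"
  proof (rule Cauchy_theorem_primitive[where S = "- {0}" and f = "\<lambda>z. z powi (n + 1) / of_int (n + 1)"])
    fix z :: complex assume "z \<in> - {0}"
    then show "((\<lambda>z. z powi (n + 1) / of_int (n + 1)) has_field_derivative z powi n) (at z within - {0})"
      using ne by (auto intro!: derivative_eq_intros)
  qed (use assms in auto)
  with False show ?thesis by simp
qed

text \<open>On the circle the series converges absolutely, hence uniformly by the Weierstrass test, so it may
  be integrated termwise; only the term \<open>n = m\<close> of the integrand contributes.\<close>

lemma contour_integral_laurent_series:
  assumes "0 < \<rho>"
    and sums: "\<And>z. cmod z = \<rho> \<Longrightarrow> ((\<lambda>n. c n * z powi n) has_sum f z) UNIV"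
  shows "contour_integral (circlepath 0 \<rho>) (\<lambda>z. f z * z powi (- m - 1)) = 2 * pi * \<i> * c m"
proof -
  define g where "g = (\<lambda>n z. c n * z powi (n - m - 1))"
  define M where "M = (\<lambda>n. cmod (c n) * \<rho> powi (n - m - 1))"
  have shift: "c n * z powi n * z powi (- m - 1) = g n z" if "z \<noteq> 0" for n z
    using power_int_add[of z n "- m - 1"] that by (simp add: g_def algebra_simps)
  have sums': "((\<lambda>n. g n z) has_sum (f z * z powi (- m - 1))) UNIV" if "cmod z = \<rho>" for z
  proof -
    have "((\<lambda>n. c n * z powi n * z powi (- m - 1)) has_sum (f z * z powi (- m - 1))) UNIV"
      by (rule has_sum_cmult_left[OF sums[OF that]])
    then show ?thesis using shift[of z] that assms(1) by auto
  qed
  have "(\<lambda>n. g n (of_real \<rho>)) summable_on UNIV"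
    using sums'[of "of_real \<rho>"] assms(1) by (auto simp: summable_on_def)
  then have "(\<lambda>n. norm (g n (of_real \<rho>))) summable_on UNIV"
    by (simp add: summable_on_iff_abs_summable_on_complex)
  then have M: "M summable_on UNIV"
    using assms(1) by (simp add: g_def M_def norm_mult norm_power_int)
  have integral_g: "(g n has_contour_integral c n * (if n = m then 2 * pi * \<i> else 0)) (circlepath 0 \<rho>)" for n
    using has_contour_integral_lmul[OF contour_integral_powi_circlepath[OF assms(1), of "n - m - 1"], of "c n"]
    by (simp add: g_def)
  have integral_sum: "((\<lambda>z. \<Sum>n\<in>F. g n z) has_contour_integral
      (\<Sum>n\<in>F. c n * (if n = m then 2 * pi * \<i> else 0))) (circlepath 0 \<rho>)" if "finite F" for F
    by (rule has_contour_integral_sum[OF that integral_g])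
  have "uniform_limit (sphere 0 \<rho>) (\<lambda>F z. \<Sum>n\<in>F. g n z) (\<lambda>z. f z * z powi (- m - 1))
      (finite_subsets_at_top UNIV)"
    by (rule Weierstrass_m_test_general'[OF _ sums' M])
       (simp_all add: g_def M_def norm_mult norm_power_int)
  then have lim: "((\<lambda>F. contour_integral (circlepath 0 \<rho>) (\<lambda>z. \<Sum>n\<in>F. g n z)) \<longlongrightarrow>
      contour_integral (circlepath 0 \<rho>) (\<lambda>z. f z * z powi (- m - 1))) (finite_subsets_at_top UNIV)"
    by (intro contour_integral_uniform_limit_circlepath(2))
       (use assms(1) integral_sum in \<open>auto simp: contour_integrable_on_def
          intro!: eventually_finite_subsets_at_top_weakI\<close>)
  have "\<forall>\<^sub>F F in finite_subsets_at_top UNIV. {m} \<subseteq> F \<and> finite F"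
    by (auto simp: eventually_finite_subsets_at_top)
  then have "\<forall>\<^sub>F F in finite_subsets_at_top UNIV.
      contour_integral (circlepath 0 \<rho>) (\<lambda>z. \<Sum>n\<in>F. g n z) = 2 * pi * \<i> * c m"
  proof (rule eventually_mono)
    fix F assume F: "{m} \<subseteq> F \<and> finite F"
    have "(\<Sum>n\<in>F. c n * (if n = m then 2 * pi * \<i> else 0)) = (\<Sum>n\<in>F. if n = m then 2 * pi * \<i> * c m else 0)"
      by (intro sum.cong) auto
    also have "\<dots> = 2 * pi * \<i> * c m" using F by simp
    finally show "contour_integral (circlepath 0 \<rho>) (\<lambda>z. \<Sum>n\<in>F. g n z) = 2 * pi * \<i> * c m"
      using contour_integral_unique[OF integral_sum] F by simp
  qed
  then have "((\<lambda>F. contour_integral (circlepath 0 \<rho>) (\<lambda>z. \<Sum>n\<in>F. g n z)) \<longlongrightarrow> 2 * pi * \<i> * c m)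
      (finite_subsets_at_top UNIV)"
    by (rule tendsto_eventually)
  then show ?thesis using lim tendsto_unique finite_subsets_at_top_neq_bot by blast
qed

lemma laurent_coeff_eqI:
  assumes "0 < \<rho>" and c: "has_laurent_series_around_circle \<rho> f c"
  shows "laurent_coeff \<rho> f = c"
  unfolding laurent_coeff_def
proof (rule the_equality, rule c)
  have "2 * pi * \<i> * d m = contour_integral (circlepath 0 \<rho>) (\<lambda>z. f z * z powi (- m - 1))"
    if "has_laurent_series_around_circle \<rho> f d" for d m
    by (rule contour_integral_laurent_series[symmetric, OF assms(1)])
       (use that in \<open>auto simp: has_laurent_series_around_circle_def\<close>)
  note integral = this
  show "d = c" if d: "has_laurent_series_around_circle \<rho> f d" for d
  proof
    fix m
    have "2 * pi * \<i> * d m = 2 * pi * \<i> * c m"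
      unfolding integral[OF d] integral[OF c] ..
    then show "d m = c m" by simp
  qed
qed

text \<open>The annulus may depend on the function; finiteness of \<open>T\<close> leaves a common one.\<close>

lemma has_laurent_series_linear_combination:
  assumes "0 < \<rho>" "finite T" "\<And>p. p \<in> T \<Longrightarrow> has_laurent_series_around_circle \<rho> (f p) (c p)"
  shows "has_laurent_series_around_circle \<rho> (\<lambda>z. \<Sum>p\<in>T. f p z * a p) (\<lambda>n. \<Sum>p\<in>T. c p n * a p)"
  using assms(2,3)
proof (induction T rule: finite_induct)
  case empty
  show ?case unfolding has_laurent_series_around_circle_def
    by (rule exI[of _ 0], rule exI[of _ "\<rho> + 1"]) (use assms(1) in auto)
next
  case (insert p T)
  obtain s1 s2 where s: "0 \<le> s1" "s1 < \<rho>" "\<rho> < s2"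
    and ss: "\<And>z. s1 < cmod z \<Longrightarrow> cmod z < s2 \<Longrightarrow> ((\<lambda>n. c p n * z powi n) has_sum f p z) UNIV"
    using insert.prems[of p] unfolding has_laurent_series_around_circle_def by auto
  obtain t1 t2 where t: "0 \<le> t1" "t1 < \<rho>" "\<rho> < t2"
    and ts: "\<And>z. t1 < cmod z \<Longrightarrow> cmod z < t2 \<Longrightarrow>
      ((\<lambda>n. (\<Sum>p\<in>T. c p n * a p) * z powi n) has_sum (\<Sum>p\<in>T. f p z * a p)) UNIV"
    using insert.IH insert.prems unfolding has_laurent_series_around_circle_def by auto
  show ?case unfolding has_laurent_series_around_circle_def
  proof (rule exI[of _ "max s1 t1"], rule exI[of _ "min s2 t2"], intro conjI allI impI)
    fix z assume z: "max s1 t1 < cmod z \<and> cmod z < min s2 t2"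
    have "((\<lambda>n. c p n * z powi n * a p + (\<Sum>p\<in>T. c p n * a p) * z powi n) has_sum
        f p z * a p + (\<Sum>p\<in>T. f p z * a p)) UNIV"
      using z by (intro has_sum_add has_sum_cmult_left ss ts) auto
    then show "((\<lambda>n. (\<Sum>p\<in>insert p T. c p n * a p) * z powi n) has_sum
        (\<Sum>p\<in>insert p T. f p z * a p)) UNIV"
      using insert.hyps by (simp add: algebra_simps)
  qed (use s t in auto)
qed

section \<open>Generating functions of the symmetric polynomials\<close>

lemma elem_sym_generating:
  assumes "finite I"
  shows "(\<Sum>r\<le>card I. elem_sym r x I * w ^ r) = (\<Prod>l\<in>I. 1 + x l * w)"
proof -
  have "(\<Prod>l\<in>I. 1 + x l * w) = (\<Prod>l\<in>I. x l * w + 1)" by (simp add: add.commute)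
  also have "\<dots> = (\<Sum>X\<in>Pow I. (\<Prod>l\<in>X. x l) * w ^ card X)"
    using assms by (subst prod_add) (simp_all add: prod.distrib)
  also have "\<dots> = (\<Sum>r\<le>card I. \<Sum>X | X \<in> Pow I \<and> card X = r. (\<Prod>l\<in>X. x l) * w ^ card X)"
    by (rule sum.group[symmetric]) (use assms in \<open>auto intro: card_mono\<close>)
  also have "\<dots> = (\<Sum>r\<le>card I. elem_sym r x I * w ^ r)"
    by (auto simp: elem_sym_def sum_distrib_right intro!: sum.cong)
  finally show ?thesis by simp
qed

lemma elem_sym_eq_0:
  assumes "finite I" "card I < r"
  shows "elem_sym r x I = 0"
proof -
  have no_subset: "{X. X \<subseteq> I \<and> card X = r} = {}"
    using assms by (auto dest: card_mono)
  show ?thesis unfolding elem_sym_def no_subset by simp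
qed

lemma complete_sym_empty: "0 < s \<Longrightarrow> complete_sym s x {} = 0"
  unfolding complete_sym_def by (rule sum.neutral) auto

lemma has_sum_times_complex:
  fixes f :: "'a \<Rightarrow> complex" and g :: "'b \<Rightarrow> complex"
  assumes f: "(f has_sum a) A" and g: "(g has_sum b) B"
  shows "((\<lambda>(x, y). f x * g y) has_sum a * b) (A \<times> B)"
proof (rule has_sum_SigmaI)
  have fa: "(\<lambda>x. norm (f x)) summable_on A" and ga: "(\<lambda>y. norm (g y)) summable_on B"
    using f g summable_on_iff_abs_summable_on_complex has_sum_imp_summable by blast+
  have "(\<lambda>p. norm (case p of (x, y) \<Rightarrow> f x * g y)) summable_on A \<times> B"
  proof (subst Infinite_Sum.abs_summable_on_Sigma_iff, intro conjI ballI)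
    show "(\<lambda>y. norm (case (x, y) of (x, y) \<Rightarrow> f x * g y)) summable_on B" for x
      using summable_on_cmult_right[OF ga] by (simp add: norm_mult)
    have "(\<lambda>x. norm (f x) * (\<Sum>\<^sub>\<infinity>y\<in>B. norm (g y))) summable_on A"
      by (rule summable_on_cmult_left[OF fa])
    then show "(\<lambda>x. norm (\<Sum>\<^sub>\<infinity>y\<in>B. norm (case (x, y) of (x, y) \<Rightarrow> f x * g y))) summable_on A"
      by (simp add: norm_mult infsum_cmult_right' abs_mult infsum_nonneg)
  qed
  then show "(\<lambda>(x, y). f x * g y) summable_on A \<times> B"
    by (simp add: summable_on_iff_abs_summable_on_complex)
  show "((\<lambda>x. f x * b) has_sum a * b) A" by (rule has_sum_cmult_left[OF f])
qed (use g in \<open>auto intro: has_sum_cmult_right\<close>)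

text \<open>This collects the terms of an unordered series by degree: by the size of a multiset, and by the
  exponent of \<open>z\<close>.\<close>

lemma has_sum_group_fibres:
  fixes f :: "'a \<Rightarrow> complex"
  assumes sum: "(f has_sum S) P" and fin: "\<And>n. finite {p \<in> P. d p = n}"
  shows "((\<lambda>n. \<Sum>p | p \<in> P \<and> d p = n. f p) has_sum S) UNIV"
proof (rule has_sum_SigmaD)
  show "((\<lambda>(n, p). f p) has_sum S) (SIGMA n:UNIV. {p \<in> P. d p = n})"
    using sum
    by (subst (asm) has_sum_reindex_bij_witness[where i = snd and j = "\<lambda>p. (d p, p)"
        and T = "SIGMA n:UNIV. {p \<in> P. d p = n}" and h = "\<lambda>(n, p). f p" and s' = S]) auto
qed (use fin in \<open>auto intro: has_sum_finite\<close>)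

text \<open>Expanding every factor \<open>1 / (1 - x\<^sub>l)\<close> as a geometric series, a choice of one term from each
  factor is a multiset, given by its multiplicities.\<close>

lemma has_sum_multisets:
  fixes x :: "'a \<Rightarrow> complex"
  assumes "finite I" "\<And>l. l \<in> I \<Longrightarrow> cmod (x l) < 1"
  shows "((\<lambda>M. \<Prod>l\<in>#M. x l) has_sum (\<Prod>l\<in>I. inverse (1 - x l))) {M. set_mset M \<subseteq> I}"
  using assms
proof (induction I rule: finite_induct)
  case empty
  have "{M :: 'a multiset. set_mset M \<subseteq> {}} = {{#}}" by auto
  then show ?case using has_sum_finite[of "{{#}}" "\<lambda>M. \<Prod>l\<in>#M. x l"] by simp
next
  case (insert a I)
  have "((\<lambda>n. x a ^ n) has_sum inverse (1 - x a)) UNIV"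
    using insert.prems[of a] by (intro norm_summable_imp_has_sum)
      (auto simp: norm_power summable_geometric inverse_eq_divide intro: geometric_sums)
  moreover have "((\<lambda>M. \<Prod>l\<in>#M. x l) has_sum (\<Prod>l\<in>I. inverse (1 - x l))) {M. set_mset M \<subseteq> I}"
    using insert.IH insert.prems by auto
  ultimately have "((\<lambda>(n, M). x a ^ n * (\<Prod>l\<in>#M. x l)) has_sum
      inverse (1 - x a) * (\<Prod>l\<in>I. inverse (1 - x l))) (UNIV \<times> {M. set_mset M \<subseteq> I})"
    by (rule has_sum_times_complex)
  \<comment> \<open>A multiset over \<open>insert a I\<close> is the multiplicity of \<open>a\<close> together with a multiset over \<open>I\<close>.\<close>
  also have "?this \<longleftrightarrow> ?case"
  proof (rule has_sum_reindex_bij_witness[where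
        j = "\<lambda>(n, M). replicate_mset n a + M" and i = "\<lambda>M. (count M a, filter_mset (\<lambda>l. l \<noteq> a) M)"])
    fix p assume "p \<in> (UNIV :: nat set) \<times> {M. set_mset M \<subseteq> I}"
    then obtain n M where p: "p = (n, M)" and M: "set_mset M \<subseteq> I" by auto
    have "a \<notin># M" using M insert.hyps by auto
    then show "(case p of (n, M) \<Rightarrow> replicate_mset n a + M) \<in> {M. set_mset M \<subseteq> insert a I}"
      and "(\<lambda>M. (count M a, filter_mset (\<lambda>l. l \<noteq> a) M)) (case p of (n, M) \<Rightarrow> replicate_mset n a + M) = p"
      and "(\<Prod>l\<in>#(case p of (n, M) \<Rightarrow> replicate_mset n a + M). x l) =
        (case p of (n, M) \<Rightarrow> x a ^ n * (\<Prod>l\<in>#M. x l))"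
      using M by (auto simp: p multiset_eq_iff not_in_iff split: if_splits)
  next
    fix M assume "M \<in> {M. set_mset M \<subseteq> insert a I}"
    then show "(count M a, filter_mset (\<lambda>l. l \<noteq> a) M) \<in> UNIV \<times> {M. set_mset M \<subseteq> I}" by auto
    show "(case (count M a, filter_mset (\<lambda>l. l \<noteq> a) M) of (n, M) \<Rightarrow> replicate_mset n a + M) = M"
      by (auto simp: multiset_eq_iff)
  qed (use insert.hyps in simp)
  finally show ?case .
qed

lemma complete_sym_generating:
  assumes K: "finite K" and small: "\<And>l. l \<in> K \<Longrightarrow> cmod (y l * u) < 1"
  shows "((\<lambda>s. complete_sym s y K * u ^ s) has_sum (\<Prod>l\<in>K. inverse (1 - y l * u))) UNIV"
proof -
  have "((\<lambda>s. \<Sum>M | M \<in> {M. set_mset M \<subseteq> K} \<and> size M = s. \<Prod>l\<in>#M. y l * u) has_sum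
      (\<Prod>l\<in>K. inverse (1 - y l * u))) UNIV"
    using K small
    by (intro has_sum_group_fibres has_sum_multisets) (use finite_multisets_of_size[OF K] in \<open>auto simp: multisets_of_size_def\<close>)
  moreover have "(\<Sum>M | M \<in> {M. set_mset M \<subseteq> K} \<and> size M = s. \<Prod>l\<in>#M. y l * u) =
      complete_sym s y K * u ^ s" for s
    by (auto simp: complete_sym_def sum_distrib_right prod_mset.distrib intro!: sum.cong)
  ultimately show ?thesis by simp
qed

text \<open>For \<open>i < j\<close>, up to the factor \<open>1 - \<alpha>\<^sub>j\<beta>\<^sub>j\<close>, the coefficient \<open>A\<^sub>i\<^sub>j\<close> with positive upper index is the
  instance \<open>x = -\<alpha>\<close>, \<open>y = \<beta>\<close>. For \<open>i > j\<close> and a negative upper index it is the instance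
  \<open>x = -\<beta>\<close>, \<open>y = \<alpha>\<close>, with the opposite sign of \<open>n\<close>: in that formula \<open>r\<close> is the degree of the complete
  factor and \<open>s\<close> that of the elementary one.\<close>

definition elem_complete_sum ::
  "(int \<Rightarrow> complex) \<Rightarrow> int set \<Rightarrow> (int \<Rightarrow> complex) \<Rightarrow> int set \<Rightarrow> int \<Rightarrow> complex" where
  "elem_complete_sum x I y K n =
     Sum_any (\<lambda>(r, s). if int r - int s = n then elem_sym r x I * complete_sym s y K else 0)"

lemma finite_difference_fibre: "finite {p \<in> {..N} \<times> (UNIV :: nat set). int (fst p) - int (snd p) = n}"
proof (rule finite_subset)
  show "{p \<in> {..N} \<times> (UNIV :: nat set). int (fst p) - int (snd p) = n} \<subseteq>
      (\<lambda>r. (r, nat (int r - n))) ` {..N}" by (force simp: image_iff)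
qed simp

text \<open>The difference \<open>r - s\<close> is the exponent of \<open>z\<close> in the product of the \<open>r\<close>-th term of the
  elementary generating polynomial in \<open>z\<close> and the \<open>s\<close>-th term of the complete generating series in
  \<open>1 / z\<close>. Since \<open>r\<close> is bounded, each exponent arises from finitely many pairs.\<close>

lemma elem_complete_generating:
  assumes I: "finite I" and K: "finite K" and z: "z \<noteq> 0" and small: "\<And>l. l \<in> K \<Longrightarrow> cmod (y l / z) < 1"
  shows "((\<lambda>n. elem_complete_sum x I y K n * z powi n) has_sum
    (\<Prod>l\<in>I. 1 + x l * z) * (\<Prod>l\<in>K. inverse (1 - y l / z))) UNIV"
proof -
  let ?P = "{..card I} \<times> (UNIV :: nat set)"
  let ?fibre = "\<lambda>n. {p. p \<in> ?P \<and> int (fst p) - int (snd p) = n}"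
  let ?t = "\<lambda>(r, s). (elem_sym r x I * z ^ r) * (complete_sym s y K * (1 / z) ^ s)"
  have e: "((\<lambda>r. elem_sym r x I * z ^ r) has_sum (\<Prod>l\<in>I. 1 + x l * z)) {..card I}"
    unfolding elem_sym_generating[OF I, symmetric] by (rule has_sum_finite) simp
  have h: "((\<lambda>s. complete_sym s y K * (1 / z) ^ s) has_sum (\<Prod>l\<in>K. inverse (1 - y l / z))) UNIV"
    using complete_sym_generating[OF K, of y "1 / z"] small by simp
  have "((\<lambda>n. \<Sum>p\<in>?fibre n. ?t p) has_sum
      (\<Prod>l\<in>I. 1 + x l * z) * (\<Prod>l\<in>K. inverse (1 - y l / z))) UNIV"
    by (rule has_sum_group_fibres[OF has_sum_times_complex[OF e h] finite_difference_fibre])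
  moreover have "(\<Sum>p\<in>?fibre n. ?t p) = elem_complete_sum x I y K n * z powi n" for n
  proof -
    have "elem_complete_sum x I y K n = (\<Sum>(r, s)\<in>?fibre n. elem_sym r x I * complete_sym s y K)"
      unfolding elem_complete_sum_def
    proof (subst Sum_any.expand_superset[OF finite_difference_fibre[of "card I" n]])
      show "{p. (case p of (r, s) \<Rightarrow> if int r - int s = n then elem_sym r x I * complete_sym s y K else 0) \<noteq> 0}
        \<subseteq> {p \<in> ?P. int (fst p) - int (snd p) = n}"
        using elem_sym_eq_0[OF I] by (auto split: if_splits simp: not_less[symmetric])
    qed (auto intro!: sum.cong)
    moreover have "z powi (int r - int s) = z ^ r * (1 / z) ^ s" for r s
      using z by (simp add: power_int_diff power_divide)
    ultimately show ?thesis
      by (auto simp: sum_distrib_right intro!: sum.cong)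
  qed
  ultimately show ?thesis by simp
qed

lemma elem_complete_sum_above_card:
  assumes "finite I" "int (card I) < n"
  shows "elem_complete_sum x I y K n = 0"
proof -
  have "(\<lambda>(r, s). if int r - int s = n then elem_sym r x I * complete_sym s y K else 0) = (\<lambda>_. 0)"
    using assms by (auto simp: fun_eq_iff intro!: elem_sym_eq_0)
  then show ?thesis by (simp add: elem_complete_sum_def)
qed

lemma elem_complete_sum_no_complete_variables:
  assumes "n < 0"
  shows "elem_complete_sum x I y {} n = 0"
proof -
  have "(\<lambda>(r, s). if int r - int s = n then elem_sym r x I * complete_sym s y {} else 0) = (\<lambda>_. 0)"
    using assms by (auto simp: fun_eq_iff intro!: complete_sym_empty)
  then show ?thesis by (simp add: elem_complete_sum_def)
qed

section \<open>The coefficient functions of the current\<close>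

text \<open>The convention for negative exponents makes \<open>F\<close> satisfy \<open>F (k + 1) = F k * g (k + 1)\<close> on both
  sides of \<open>0\<close>, so ratios of shifted powers do not depend on the position of the origin.\<close>

lemma shifted_product_split:
  fixes g F :: "int \<Rightarrow> complex"
  assumes F: "\<And>k. F k = (if k \<ge> 0 then \<Prod>i\<in>{1..k}. g i else \<Prod>i\<in>{k+1..0}. inverse (g i))"
    and "a \<le> b" "\<And>l. a < l \<Longrightarrow> l \<le> b \<Longrightarrow> g l \<noteq> 0"
  shows "F b = F a * (\<Prod>l\<in>{a<..b}. g l)"
  using assms(2,3)
proof (induction b rule: int_ge_induct)
  case (step k)
  have "F (k + 1) = F k * g (k + 1)"
  proof (cases "k \<ge> 0")
    case True
    then have "{1..k + 1} = insert (k + 1) {1..k}" by auto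
    with True show ?thesis by (simp add: F)
  next
    case False
    then have "{k + 1..0} = insert (k + 1) {k + 1 + 1..0}" by auto
    then have "F k = inverse (g (k + 1)) * F (k + 1)"
      using False by (cases "k = -1") (simp_all add: F)
    then show ?thesis using step.prems[of "k + 1"] step.hyps by simp
  qed
  moreover have "{a<..k + 1} = insert (k + 1) {a<..k}" using step.hyps by auto
  ultimately show ?case using step by simp
qed simp

lemma shifted_pow_semi_split:
  assumes "a \<le> b" "\<And>l. a < l \<Longrightarrow> l \<le> b \<Longrightarrow> 1 - z * \<alpha> l \<noteq> 0"
  shows "shifted_pow_semi z \<alpha> b = shifted_pow_semi z \<alpha> a * (\<Prod>l\<in>{a<..b}. 1 - z * \<alpha> l)"
  using assms by (intro shifted_product_split) (auto simp: shifted_pow_semi_def)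

lemma shifted_pow_bar_split:
  assumes "a \<le> b" "\<And>l. a < l \<Longrightarrow> l \<le> b \<Longrightarrow> z - \<beta> l \<noteq> 0"
  shows "shifted_pow_bar z \<beta> b = shifted_pow_bar z \<beta> a * (\<Prod>l\<in>{a<..b}. z - \<beta> l)"
  using assms by (intro shifted_product_split) (auto simp: shifted_pow_bar_def)

text \<open>The formula with positive upper index holds for all \<open>k\<close>: if \<open>k \<le> 0\<close>, then \<open>r - s = j - i - k\<close>
  forces \<open>r\<close> to exceed the number \<open>j - i - 1\<close> of variables of the elementary factor. On the left
  side, for \<open>k < 0\<close>, the complete polynomial has positive degree in an empty set of variables.\<close>

lemma A_coeff_less:
  assumes "i < j"
  shows "A_coeff \<alpha> \<beta> k i j = (1 - \<alpha> j * \<beta> j) *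
    elem_complete_sum (\<lambda>l. - \<alpha> l) {i<..<j} \<beta> {i..j} (j - i - k)"
proof (cases "k > 0")
  case True
  with assms show ?thesis by (simp add: A_coeff_def elem_complete_sum_def)
next
  case False
  have "elem_complete_sum (\<lambda>l. - \<alpha> l) {i<..<j} \<beta> {i..j} (j - i - k) = 0"
    using False assms by (intro elem_complete_sum_above_card) auto
  moreover have "(\<lambda>(r, s). if int r - int s = j - i - k
      then complete_sym r \<alpha> {j..i} * elem_sym s (\<lambda>l. - \<beta> l) {j<..<i} else 0) = (\<lambda>_. 0)"
    using False assms by (auto simp: fun_eq_iff intro!: complete_sym_empty)
  ultimately show ?thesis using False assms by (simp add: A_coeff_def)
qed

text \<open>The mirror image: now the formula with negative upper index persists for \<open>k \<ge> 0\<close>.\<close>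

lemma A_coeff_greater:
  assumes "j < i"
  shows "A_coeff \<alpha> \<beta> k i j = (1 - \<alpha> j * \<beta> j) *
    elem_complete_sum (\<lambda>l. - \<beta> l) {j<..<i} \<alpha> {j..i} (i - j + k)"
proof (cases "k < 0")
  case True
  have "Sum_any (\<lambda>(r, s). if int r - int s = j - i - k
      then complete_sym r \<alpha> {j..i} * elem_sym s (\<lambda>l. - \<beta> l) {j<..<i} else 0) =
    elem_complete_sum (\<lambda>l. - \<beta> l) {j<..<i} \<alpha> {j..i} (i - j + k)"
    unfolding elem_complete_sum_def
    by (rule Sum_any.reindex_cong[where l = prod.swap]) (auto simp: fun_eq_iff)
  with True assms show ?thesis by (simp add: A_coeff_def)
next
  case False
  have "elem_complete_sum (\<lambda>l. - \<beta> l) {j<..<i} \<alpha> {j..i} (i - j + k) = 0"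
    using False assms by (intro elem_complete_sum_above_card) auto
  moreover have "elem_complete_sum (\<lambda>l. - \<alpha> l) {i<..<j} \<beta> {i..j} (j - i - k) = 0"
    using False assms elem_complete_sum_no_complete_variables by simp
  moreover have "A_coeff \<alpha> \<beta> k i j = (if k = 0 then 0 else (1 - \<alpha> j * \<beta> j) *
      elem_complete_sum (\<lambda>l. - \<alpha> l) {i<..<j} \<beta> {i..j} (j - i - k))"
    using False assms unfolding A_coeff_def elem_complete_sum_def by auto
  ultimately show ?thesis by simp
qed

text \<open>By partial fractions the sum is \<open>1 / (1 - a z) + (b / z) / (1 - b / z)\<close>; the first summand gives
  the powers \<open>z\<^sup>n\<close> with \<open>n \<ge> 0\<close>, the second those with \<open>n < 0\<close>.\<close>

lemma has_sum_diagonal_kernel: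
  fixes a b z :: complex
  assumes z: "z \<noteq> 0" and a: "cmod (a * z) < 1" and b: "cmod (b / z) < 1"
  shows "((\<lambda>n. (if n \<ge> 0 then a ^ nat n else b ^ nat (- n)) * z powi n) has_sum
    (1 - a * b) * z / ((1 - z * a) * (z - b))) UNIV"
proof -
  let ?f = "\<lambda>n. (if n \<ge> 0 then a ^ nat n else b ^ nat (- n)) * z powi n"
  have "((\<lambda>n. (a * z) ^ n) has_sum 1 / (1 - a * z)) UNIV"
    using a by (intro norm_summable_imp_has_sum)
      (auto simp: norm_power summable_geometric intro: geometric_sums)
  then have pos: "(?f has_sum 1 / (1 - a * z)) {0..}"
    by (subst (asm) has_sum_reindex_bij_witness[where i = nat and j = int and T = "{0..}" and h = ?f,
        OF _ _ _ _ _ refl]) (auto simp: power_mult_distrib)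
  have "((\<lambda>n. (b / z) ^ n) has_sum (b / z) / (1 - b / z)) {1..}"
    by (rule has_sum_geometric_from_1[OF b])
  then have neg: "(?f has_sum (b / z) / (1 - b / z)) {..<0}"
    by (subst (asm) has_sum_reindex_bij_witness[where i = "\<lambda>n. nat (- n)" and j = "\<lambda>n. - int n"
        and T = "{..<0}" and h = ?f, OF _ _ _ _ _ refl])
       (auto simp: power_divide power_int_minus field_simps)
  have "(?f has_sum 1 / (1 - a * z) + (b / z) / (1 - b / z)) ({0..} \<union> {..<0})"
    by (rule has_sum_Un_disjoint[OF pos neg]) auto
  moreover have "{0..} \<union> {..<0} = (UNIV :: int set)" by auto
  moreover have "1 / (1 - a * z) + (b / z) / (1 - b / z) = (1 - a * b) * z / ((1 - z * a) * (z - b))"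
  proof -
    have "1 - a * z \<noteq> 0" using a by auto
    moreover have "z - b \<noteq> 0" using b z by auto
    ultimately have "1 / (1 - a * z) + b / (z - b) =
        ((z - b) + b * (1 - a * z)) / ((1 - a * z) * (z - b))"
      by (simp add: add_frac_eq)
    also have "b / (z - b) = (b / z) / (1 - b / z)" using z by (simp add: field_simps)
    also have "(z - b) + b * (1 - a * z) = (1 - a * b) * z" by (simp add: algebra_simps)
    finally show ?thesis by (simp add: mult.commute)
  qed
  ultimately show ?thesis by simp
qed

text \<open>The bounds on \<open>\<alpha>\<close> and \<open>\<beta>\<close> are required on an interval that contains \<open>0\<close>, not only
  between \<open>i\<close> and \<open>j\<close>: the factors between the origin and \<open>i\<close> or \<open>j\<close> cancel, but division by
  zero would spoil the cancellation. The strict lower bounds on \<open>i\<close> and \<open>j\<close> keep \<open>i - 1\<close> and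
  \<open>j - 1\<close> in the interval.\<close>

lemma has_sum_kernel:
  fixes \<alpha> \<beta> :: "int \<Rightarrow> complex"
  assumes z: "z \<noteq> 0" and ij: "- N < i" "i \<le> N" "- N < j" "j \<le> N"
    and small: "\<And>l. - N \<le> l \<Longrightarrow> l \<le> N \<Longrightarrow> cmod (\<alpha> l * z) < 1"
      "\<And>l. - N \<le> l \<Longrightarrow> l \<le> N \<Longrightarrow> cmod (\<beta> l / z) < 1"
  shows "((\<lambda>n. A_coeff \<alpha> \<beta> (- n) i j * z powi n) has_sum
    deformed_psi \<alpha> \<beta> z i * deformed_psi_star \<alpha> \<beta> z j) UNIV"
proof -
  have nza: "1 - z * \<alpha> l \<noteq> 0" if "- N \<le> l" "l \<le> N" for l
    using small(1)[OF that] by (auto simp: mult.commute)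
  have nzb: "z - \<beta> l \<noteq> 0" if "- N \<le> l" "l \<le> N" for l
    using small(2)[OF that] z by auto
  have semi_nz: "shifted_pow_semi z \<alpha> k \<noteq> 0" if "- N \<le> k" "k \<le> N" for k
    using that nza by (auto simp: shifted_pow_semi_def)
  have bar_nz: "shifted_pow_bar z \<beta> k \<noteq> 0" if "- N \<le> k" "k \<le> N" for k
    using that nzb by (auto simp: shifted_pow_bar_def)
  define C where "C = 1 - \<alpha> j * \<beta> j"
  have cancel_less: "z * b / s * (C * (s * P) / (b * (p * Q))) = C * (z / p) * P * inverse Q"
    and cancel_greater: "z * (b * (p * P)) / (s * Q) * (C * s / b) = C * (z * p) * P * inverse Q"
    if "s \<noteq> 0" "b \<noteq> 0" for b s p P Q :: complex
  proof -
    have "b * (s * (inverse b * inverse s)) = 1" using that by (simp add: field_simps)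
    then show "z * b / s * (C * (s * P) / (b * (p * Q))) = C * (z / p) * P * inverse Q"
      and "z * (b * (p * P)) / (s * Q) * (C * s / b) = C * (z * p) * P * inverse Q"
      by (simp_all add: divide_inverse mult_ac)
  qed
  consider "i < j" | "i = j" | "j < i" by linarith
  then show ?thesis
  proof cases
    case 1
    let ?E = "elem_complete_sum (\<lambda>l. - \<alpha> l) {i<..<j} \<beta> {i..j}"
    let ?G = "(\<Prod>l\<in>{i<..<j}. 1 + - \<alpha> l * z) * (\<Prod>l\<in>{i..j}. inverse (1 - \<beta> l / z))"
    have semi: "shifted_pow_semi z \<alpha> (j - 1) = shifted_pow_semi z \<alpha> i * (\<Prod>l\<in>{i<..j - 1}. 1 - z * \<alpha> l)"
      using 1 ij by (intro shifted_pow_semi_split nza) auto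
    have bar: "shifted_pow_bar z \<beta> j = shifted_pow_bar z \<beta> (i - 1) * (\<Prod>l\<in>{i - 1<..j}. z - \<beta> l)"
      using 1 ij by (intro shifted_pow_bar_split nzb) auto
    have sets: "{i<..j - 1} = {i<..<j}" "{i - 1<..j} = {i..j}" by auto
    have "(\<Prod>l\<in>{i..j}. z - \<beta> l) = (\<Prod>l\<in>{i..j}. z * (1 - \<beta> l / z))"
      using z by (intro prod.cong) (auto simp: field_simps)
    also have "\<dots> = z powi (j - i + 1) * (\<Prod>l\<in>{i..j}. 1 - \<beta> l / z)"
      using 1 by (simp add: prod.distrib power_int_def)
    finally have bar': "(\<Prod>l\<in>{i..j}. z - \<beta> l) = z powi (j - i + 1) * (\<Prod>l\<in>{i..j}. 1 - \<beta> l / z)" .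
    have powz: "z / z powi (j - i + 1) = z powi (i - j)"
      using power_int_diff[of z 1 "j - i + 1"] z by simp
    have "deformed_psi \<alpha> \<beta> z i * deformed_psi_star \<alpha> \<beta> z j =
        C * (z / z powi (j - i + 1)) * (\<Prod>l\<in>{i<..<j}. 1 - z * \<alpha> l) * inverse (\<Prod>l\<in>{i..j}. 1 - \<beta> l / z)"
      unfolding deformed_psi_def deformed_psi_star_def semi bar sets bar' C_def[symmetric]
      by (rule cancel_less) (use semi_nz[of i] bar_nz[of "i - 1"] ij in auto)
    then have kernel: "deformed_psi \<alpha> \<beta> z i * deformed_psi_star \<alpha> \<beta> z j = C * z powi (i - j) * ?G"
      by (simp add: powz prod_inversef[symmetric] o_def mult.commute mult.left_commute)
    have "((\<lambda>n. ?E n * z powi n) has_sum ?G) UNIV"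
      using 1 ij small z by (intro elem_complete_generating) auto
    then have "((\<lambda>n. C * z powi (i - j) * (?E n * z powi n)) has_sum C * z powi (i - j) * ?G) UNIV"
      by (rule has_sum_cmult_right)
    \<comment> \<open>The prefactor shifts exponents by \<open>i - j\<close>, so \<open>z\<^sup>m\<close> comes from the term \<open>n = j - i + m\<close>.\<close>
    moreover have "bij (\<lambda>m. j - i + m)" by (rule bij_plus)
    ultimately have "((\<lambda>m. C * z powi (i - j) * (?E (j - i + m) * z powi (j - i + m))) has_sum
        C * z powi (i - j) * ?G) UNIV"
      by (subst has_sum_reindex_bij_betw)
    moreover have "C * z powi (i - j) * (?E (j - i + m) * z powi (j - i + m)) =
        A_coeff \<alpha> \<beta> (- m) i j * z powi m" for m
      using power_int_add[of z "i - j" "j - i + m"] z 1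
      by (simp add: A_coeff_less C_def algebra_simps)
    ultimately show ?thesis by (simp add: kernel)
  next
    case 2
    have "shifted_pow_semi z \<alpha> j = shifted_pow_semi z \<alpha> (j - 1) * (\<Prod>l\<in>{j - 1<..j}. 1 - z * \<alpha> l)"
      using ij by (intro shifted_pow_semi_split nza) auto
    moreover have "shifted_pow_bar z \<beta> j = shifted_pow_bar z \<beta> (j - 1) * (\<Prod>l\<in>{j - 1<..j}. z - \<beta> l)"
      using ij by (intro shifted_pow_bar_split nzb) auto
    moreover have "{j - 1<..j} = {j}" by auto
    ultimately have kernel: "deformed_psi \<alpha> \<beta> z i * deformed_psi_star \<alpha> \<beta> z j =
        (1 - \<alpha> j * \<beta> j) * z / ((1 - z * \<alpha> j) * (z - \<beta> j))"
      using semi_nz[of "j - 1"] bar_nz[of "j - 1"] ij 2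
      by (simp add: deformed_psi_def deformed_psi_star_def)
    have "A_coeff \<alpha> \<beta> (- n) i j = (if n \<ge> 0 then \<alpha> j ^ nat n else \<beta> j ^ nat (- n))" for n
      using 2 by (auto simp: A_coeff_def)
    then show ?thesis using has_sum_diagonal_kernel[of z "\<alpha> j" "\<beta> j"] small[of j] ij z
      by (simp add: kernel)
  next
    case 3
    let ?E = "elem_complete_sum (\<lambda>l. - \<beta> l) {j<..<i} \<alpha> {j..i}"
    let ?G = "(\<Prod>l\<in>{j<..<i}. 1 + - \<beta> l * (1 / z)) * (\<Prod>l\<in>{j..i}. inverse (1 - \<alpha> l / (1 / z)))"
    have semi: "shifted_pow_semi z \<alpha> i = shifted_pow_semi z \<alpha> (j - 1) * (\<Prod>l\<in>{j - 1<..i}. 1 - z * \<alpha> l)"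
      using 3 ij by (intro shifted_pow_semi_split nza) auto
    have bar: "shifted_pow_bar z \<beta> (i - 1) = shifted_pow_bar z \<beta> j * (\<Prod>l\<in>{j<..i - 1}. z - \<beta> l)"
      using 3 ij by (intro shifted_pow_bar_split nzb) auto
    have sets: "{j<..i - 1} = {j<..<i}" "{j - 1<..i} = {j..i}" by auto
    have "(\<Prod>l\<in>{j<..<i}. z - \<beta> l) = (\<Prod>l\<in>{j<..<i}. z * (1 - \<beta> l / z))"
      using z by (intro prod.cong) (auto simp: field_simps)
    also have "\<dots> = z powi (i - j - 1) * (\<Prod>l\<in>{j<..<i}. 1 - \<beta> l / z)"
      using 3 by (simp add: prod.distrib power_int_def diff_diff_eq)
    finally have bar': "(\<Prod>l\<in>{j<..<i}. z - \<beta> l) = z powi (i - j - 1) * (\<Prod>l\<in>{j<..<i}. 1 - \<beta> l / z)" .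
    have powz: "z * z powi (i - j - 1) = z powi (i - j)"
      using power_int_add[of z 1 "i - j - 1"] z by simp
    have "deformed_psi \<alpha> \<beta> z i * deformed_psi_star \<alpha> \<beta> z j =
        C * (z * z powi (i - j - 1)) * (\<Prod>l\<in>{j<..<i}. 1 - \<beta> l / z) * inverse (\<Prod>l\<in>{j..i}. 1 - z * \<alpha> l)"
      unfolding deformed_psi_def deformed_psi_star_def semi bar sets bar' C_def[symmetric]
      by (rule cancel_greater) (use semi_nz[of "j - 1"] bar_nz[of j] ij in auto)
    then have kernel: "deformed_psi \<alpha> \<beta> z i * deformed_psi_star \<alpha> \<beta> z j = C * z powi (i - j) * ?G"
      by (simp add: powz prod_inversef[symmetric] o_def mult.commute mult.left_commute)
    have "((\<lambda>n. ?E n * (1 / z) powi n) has_sum ?G) UNIV"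
      using 3 ij small z by (intro elem_complete_generating) auto
    then have "((\<lambda>n. C * z powi (i - j) * (?E n * (1 / z) powi n)) has_sum C * z powi (i - j) * ?G) UNIV"
      by (rule has_sum_cmult_right)
    \<comment> \<open>The series is in powers of \<open>1 / z\<close>, so \<open>z\<^sup>m\<close> comes from the term with \<open>i - j - n = m\<close>.\<close>
    moreover have "bij (\<lambda>m. i - j - m)"
      by (rule bijI') (auto intro: exI[of _ "i - j - _"])
    ultimately have "((\<lambda>m. C * z powi (i - j) * (?E (i - j - m) * (1 / z) powi (i - j - m))) has_sum
        C * z powi (i - j) * ?G) UNIV"
      by (subst has_sum_reindex_bij_betw)
    moreover have "C * z powi (i - j) * (?E (i - j - m) * (1 / z) powi (i - j - m)) =
        A_coeff \<alpha> \<beta> (- m) i j * z powi m" for m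
    proof -
      have pow: "z powi (i - j) * (1 / z) powi (i - j - m) = z powi m"
        using power_int_diff[of z "i - j" "i - j - m"] z
        by (simp add: power_int_divide_distrib)
      have "C * z powi (i - j) * (?E (i - j - m) * (1 / z) powi (i - j - m)) =
          C * ?E (i - j - m) * (z powi (i - j) * (1 / z) powi (i - j - m))"
        by (simp only: mult_ac)
      also have "\<dots> = A_coeff \<alpha> \<beta> (- m) i j * z powi m"
        unfolding pow using 3 by (simp add: A_coeff_greater C_def)
      finally show ?thesis .
    qed
    ultimately show ?thesis by (simp add: kernel)
  qed
qed

lemma outer_radius_exists:
  assumes "finite L" "\<And>l. l \<in> L \<Longrightarrow> \<alpha> l \<noteq> 0 \<Longrightarrow> \<rho> < cmod (inverse (\<alpha> l))"
  shows "\<exists>s>\<rho>. \<forall>l\<in>L. \<forall>z. cmod z < s \<longrightarrow> cmod (\<alpha> l * z) < 1"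
  using assms
proof (induction L rule: finite_induct)
  case empty
  show ?case by (rule exI[of _ "\<rho> + 1"]) simp
next
  case (insert a L)
  then obtain s where s: "s > \<rho>" "\<forall>l\<in>L. \<forall>z. cmod z < s \<longrightarrow> cmod (\<alpha> l * z) < 1" by auto
  show ?case
  proof (cases "\<alpha> a = 0")
    case True
    then show ?thesis using s by (intro exI[of _ s]) auto
  next
    case False
    have "cmod (\<alpha> a * z) < 1" if "cmod z < cmod (inverse (\<alpha> a))" for z
      using that False by (simp add: norm_mult norm_divide inverse_eq_divide field_simps)
    then show ?thesis using s insert.prems[of a] False
      by (intro exI[of _ "min s (cmod (inverse (\<alpha> a)))"]) auto
  qed
qed

text \<open>The bounds on all \<open>\<beta>\<^sub>l\<close> and \<open>\<alpha>\<^sub>l\<close> need not be uniform in \<open>l\<close>, so there may be no annulus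
  that works for all \<open>i\<close> and \<open>j\<close> at once; for fixed \<open>i\<close> and \<open>j\<close> only finitely many \<open>l\<close> matter.\<close>

lemma has_laurent_series_kernel:
  assumes \<beta>: "\<And>i. cmod (\<beta> i) < \<rho>"
    and \<alpha>: "\<And>j. \<alpha> j \<noteq> 0 \<Longrightarrow> \<rho> < cmod (inverse (\<alpha> j))"
  shows "has_laurent_series_around_circle \<rho>
    (\<lambda>z. deformed_psi \<alpha> \<beta> z i * deformed_psi_star \<alpha> \<beta> z j) (\<lambda>n. A_coeff \<alpha> \<beta> (- n) i j)"
proof -
  have "0 < \<rho>" using \<beta>[of 0] norm_ge_zero[of "\<beta> 0"] by linarith
  define N where "N = max \<bar>i\<bar> \<bar>j\<bar> + 1"
  define s1 where "s1 = Max (insert 0 ((\<lambda>l. cmod (\<beta> l)) ` {- N..N}))"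
  have s1: "cmod (\<beta> l) \<le> s1" if "- N \<le> l" "l \<le> N" for l
    unfolding s1_def by (rule Max_ge) (use that in auto)
  have s1_bounds: "0 \<le> s1" "s1 < \<rho>"
    using \<open>0 < \<rho>\<close> \<beta> by (auto simp: s1_def)
  obtain s2 where s2: "s2 > \<rho>" "\<forall>l\<in>{- N..N}. \<forall>z. cmod z < s2 \<longrightarrow> cmod (\<alpha> l * z) < 1"
    using outer_radius_exists[of "{- N..N}" \<alpha> \<rho>] \<alpha> by auto
  show ?thesis unfolding has_laurent_series_around_circle_def
  proof (rule exI[of _ s1], rule exI[of _ s2], intro conjI allI impI)
    fix z assume z: "s1 < cmod z \<and> cmod z < s2"
    then have "z \<noteq> 0" using s1_bounds by auto
    have "cmod (\<beta> l / z) < 1" if "- N \<le> l" "l \<le> N" for l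
      using s1[OF that] z \<open>z \<noteq> 0\<close> by (simp add: norm_divide)
    then show "((\<lambda>n. A_coeff \<alpha> \<beta> (- n) i j * z powi n) has_sum
        deformed_psi \<alpha> \<beta> z i * deformed_psi_star \<alpha> \<beta> z j) UNIV"
      using s2 z \<open>z \<noteq> 0\<close> by (intro has_sum_kernel[where N = N]) (auto simp: N_def)
  qed (use s1_bounds s2 in auto)
qed

lemma quadratic_operator_eq_sum:
  "quadratic_operator c v U =
    (\<Sum>p | Poly_Mapping.lookup (normal_ordered (fst p) (snd p) v) U \<noteq> 0.
      c (fst p) (snd p) * Poly_Mapping.lookup (normal_ordered (fst p) (snd p) v) U)"
proof -
  have fin: "finite {p. Poly_Mapping.lookup (normal_ordered (fst p) (snd p) v) U \<noteq> 0}"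
    using finite_normal_ordered_support[of v U] by (simp add: case_prod_unfold)
  show ?thesis unfolding quadratic_operator_def
    by (subst Sum_any.expand_superset[OF fin]) (auto simp: case_prod_unfold)
qed

theorem proposition4p6:
  fixes \<alpha> \<beta> :: "int \<Rightarrow> complex" and \<rho> :: real
  assumes "\<And>i. cmod (\<beta> i) < \<rho>"
    and "\<And>j. \<alpha> j \<noteq> 0 \<Longrightarrow> \<rho> < cmod (inverse (\<alpha> j))"
  shows "\<forall>k :: int. deformed_current \<rho> \<alpha> \<beta> k = quadratic_operator (A_coeff \<alpha> \<beta> k)"
proof (intro allI ext)
  fix k v U
  let ?T = "{p. Poly_Mapping.lookup (normal_ordered (fst p) (snd p) v) U \<noteq> 0}"
  let ?m = "\<lambda>p. Poly_Mapping.lookup (normal_ordered (fst p) (snd p) v) U"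
  have "0 < \<rho>" using assms(1)[of 0] norm_ge_zero[of "\<beta> 0"] by linarith
  have "finite ?T" using finite_normal_ordered_support[of v U] by (simp add: case_prod_unfold)
  have "has_laurent_series_around_circle \<rho>
      (\<lambda>z. \<Sum>p\<in>?T. deformed_psi \<alpha> \<beta> z (fst p) * deformed_psi_star \<alpha> \<beta> z (snd p) * ?m p)
      (\<lambda>n. \<Sum>p\<in>?T. A_coeff \<alpha> \<beta> (- n) (fst p) (snd p) * ?m p)"
    by (intro has_laurent_series_linear_combination has_laurent_series_kernel assms \<open>0 < \<rho>\<close> \<open>finite ?T\<close>)
  from laurent_coeff_eqI[OF \<open>0 < \<rho>\<close> this]
  show "deformed_current \<rho> \<alpha> \<beta> k v U = quadratic_operator (A_coeff \<alpha> \<beta> k) v U"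
    by (simp add: deformed_current_def current_field_def normal_ordered_product_def
        quadratic_operator_eq_sum)
qed

end
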